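(* Let $\Omega\subset\mathbb{R}^2$ be a bounded open set with locally Lipschitz boundary, let $w:M^{2\times 2}_{sym}(\mathbb{R})\to\mathbb{R}$ be a quadratic, strictly positive definite function, let $G>0$ and $l>0$ be constants, and let $\mathbf{u}_0:\partial\Omega\to\mathbb{R}^2$ be a continuous (hence bounded) function. Fix $\delta>0$. Let $\varepsilon$ range over a sequence of positive numbers converging to $0$; for each such $\varepsilon$ let $F_\varepsilon$ be a distribution of micro-fractures at scale $\varepsilon$, and let $\mathbf{u}_\varepsilon\in Adm(F_\varepsilon,\mathbf{u}_0)$ be a $\delta$-approximate minimizer of $E_\varepsilon$ over $Adm(F_\varepsilon,\mathbf{u}_0)$. Suppose that the sequence $$\inf\left\{E_\varepsilon(\mathbf{v}) : \mathbf{v}\in Adm(F_\varepsilon,\mathbf{u}_0)\right\}$$ is bounded. Let $M(\varepsilon,l)$ be the number of active cells associated with $\mathbf{u}_\varepsilon$, and let $$Damaged(\varepsilon,\Omega)=\bigcup_{D_z \text{ active}} D_z .$$ Then, as $\varepsilon\to 0$ along the sequence, $M(\varepsilon,l)=O(1/\varepsilon)$ and $\mathrm{Area}(Damaged(\varepsilon,\Omega))=O(\varepsilon)$; that is, there is a constant $C$ independent of $\varepsilon$ such that $M(\varepsilon,l)\le C/\varepsilon$ and $\mathrm{Area}(Damaged(\varepsilon,\Omega))\le C\varepsilon$ for all $\varepsilon$ in the sequence.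
   Context: Notation. $M^{2\times 2}_{sym}(\mathbb{R})$ is the space of real symmetric $2\times2$ matrices, $\mathcal{H}^1$ is the one-dimensional Hausdorff measure, and Area is two-dimensional Lebesgue measure. Cells. $Y=[0,1]^2$. For $\varepsilon>0$, $\mathbb{Z}(\varepsilon,\Omega)$ is the (finite) set of points $z=(\varepsilon m,\varepsilon n)$, $m,n\in\mathbb{Z}$, such that $z+\varepsilon Y\subset\Omega$. For $z\in\mathbb{Z}(\varepsilon,\Omega)$ the associated cell is $D_z=z+\varepsilon Y$. Micro-fractures. A distribution of micro-fractures at scale $\varepsilon$ is a set of the form $F_\varepsilon=\bigcup_{z\in\mathbb{Z}(\varepsilon,\Omega)}(z+\varepsilon F_z)$, where each $F_z$ is a Lipschitz curve with $F_z\subset(0,1)^2$. No relation is assumed between $F_\varepsilon$ and $F_{\varepsilon'}$ for different scales. Special functions with bounded deformation. For $\mathbf{u}\in L^1(\Omega,\mathbb{R}^2)$, $E\mathbf{u}$ denotes the symmetric part of the distributional derivative of $\mathbf{u}$. $S_u$ is the set of points of $\Omega$ at which $\mathbf{u}$ has no approximate limit (the complement of the Lebesgue set). $J_u$ is the set of points $x\in\Omega$ at which $\mathbf{u}$ has two different one-sided approximate limits with respect to some point-dependent direction $\nu(x)$ (that is, on the two half-discs centred at $x$ determined by $\nu(x)$). $SBD(\Omega)$ is the set of $\mathbf{u}\in L^1(\Omega,\mathbb{R}^2)$ such that $E\mathbf{u}$ is a measure of finite total variation, $|E\mathbf{u}|(\Omega)<+\infty$, and its singular part (with respect to Lebesgue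 measure) $E^s\mathbf{u}$ satisfies $|E^s\mathbf{u}|(\Omega\setminus J_u)=0$. For $\mathbf{u}\in SBD(\Omega)$, $e(\mathbf{u})$ denotes the approximate symmetric gradient, i.e. the density of the absolutely continuous part of $E\mathbf{u}$; it equals $\frac12(\nabla\mathbf{u}+(\nabla\mathbf{u})^T)$ where $\nabla \mathbf{u}$ is the (approximate) gradient. Boundary condition. For $\mathbf{u}\in SBD(\Omega)$, "$\mathbf{u}=\mathbf{u}_0$ on $\partial\Omega$" means: for every $x\in\partial\Omega$, if there exists $\mathbf{v}(x)$ with $$\lim_{\rho\to0^+}\frac{\int_{B_\rho(x)\cap\Omega}|\mathbf{u}(y)-\mathbf{v}(x)|\,dy}{|B_\rho(x)\cap\Omega|}=0,$$ then $\mathbf{v}(x)=\mathbf{u}_0(x)$. Admissible displacements. $Adm(F_\varepsilon,\mathbf{u}_0)$ is the set of all $\mathbf{u}\in SBD(\Omega)$ such that $\mathbf{u}=\mathbf{u}_0$ on $\partial\Omega$ and $F_\varepsilon\subset S_u$. Energy. For $\mathbf{u}\in Adm(F_\varepsilon,\mathbf{u}_0)$, $$E_\varepsilon(\mathbf{u})=\int_\Omega w(e(\mathbf{u}))\,dx+G\,\mathcal{H}^1(S_u\setminus F_\varepsilon).$$ Approximate minimizers. $\mathbf{u}\in Adm(F_\varepsilon,\mathbf{u}_0)$ is a $\delta$-approximate minimizer if $E_\varepsilon(\mathbf{u})\le\delta+\inf\{E_\varepsilon(\mathbf{v}):\mathbf{v}\in Adm(F_\varepsilon,\mathbf{u}_0)\}$.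 Active cells. For a $\delta$-approximate minimizer $\mathbf{u}$ and $z\in\mathbb{Z}(\varepsilon,\Omega)$, the emergent crack in the cell $D_z$ is $S_u(z)=(z+\varepsilon Y)\cap\left(S_u\setminus(z+\varepsilon F_z)\right)$. The cell $D_z$ is active if $\mathcal{H}^1(S_u(z))\ge\varepsilon l$. $M(\varepsilon,l)$ is the number of active cells (for the given $\mathbf{u}=\mathbf{u}_\varepsilon$). *)

theory Defs
  imports "HOL-Analysis.Analysis"
begin

type_synonym plane = "real^2"
type_synonym matrix2 = "real^2^2"


section \<open>Domains, curves and quadratic forms\<close>

text \<open>Near each boundary point, in a suitable orthonormal frame, the set is the strict epigraph of
  a Lipschitz function.\<close>

definition locally_lipschitz_boundary :: "plane set \<Rightarrow> bool" where
  "locally_lipschitz_boundary \<Omega> \<longleftrightarrow>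
     (\<forall>x\<in>frontier \<Omega>. \<exists>r>0. \<exists>\<tau> \<nu> :: plane. \<exists>g :: real \<Rightarrow> real. \<exists>L.
        norm \<tau> = 1 \<and> norm \<nu> = 1 \<and> \<tau> \<bullet> \<nu> = 0 \<and> L-lipschitz_on UNIV g \<and>
        (\<forall>y\<in>ball x r. y \<in> \<Omega> \<longleftrightarrow> g (y \<bullet> \<tau>) < y \<bullet> \<nu>))"

definition lipschitz_curve :: "plane set \<Rightarrow> bool" where
  "lipschitz_curve K \<longleftrightarrow> (\<exists>\<gamma> L. L-lipschitz_on {0..1} \<gamma> \<and> K = path_image \<gamma>)"

definition symmetric_matrices :: "matrix2 set" where
  "symmetric_matrices = {A. transpose A = A}"

text \<open>Only the values of \<open>w\<close> on symmetric matrices matter below.\<close>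

definition quadratic_on_symmetric :: "(matrix2 \<Rightarrow> real) \<Rightarrow> bool" where
  "quadratic_on_symmetric w \<longleftrightarrow>
     (\<exists>b :: matrix2 \<Rightarrow> matrix2 \<Rightarrow> real. bilinear b \<and> (\<forall>A\<in>symmetric_matrices. w A = b A A))"

definition positive_definite_on_symmetric :: "(matrix2 \<Rightarrow> real) \<Rightarrow> bool" where
  "positive_definite_on_symmetric w \<longleftrightarrow> (\<forall>A\<in>symmetric_matrices. A \<noteq> 0 \<longrightarrow> 0 < w A)"


section \<open>One-dimensional Hausdorff measure\<close>

text \<open>An outer measure defined on all subsets. The usual normalising factor
  (half the length of \<open>[-1, 1]\<close>) is 1 in dimension one.\<close>

definition hausdorff1_pre :: "real \<Rightarrow> 'a::metric_space set \<Rightarrow> ennreal" where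
  "hausdorff1_pre d A =
     (INF C\<in>{C :: nat \<Rightarrow> 'a set. A \<subseteq> (\<Union>i. C i) \<and> (\<forall>i. bounded (C i) \<and> diameter (C i) \<le> d)}.
        \<Sum>i. ennreal (diameter (C i)))"

definition hausdorff1 :: "'a::metric_space set \<Rightarrow> ennreal" where
  "hausdorff1 A = (SUP d\<in>{0<..}. hausdorff1_pre d A)"


section \<open>Signed and vector-valued measures\<close>

definition vector_measure :: "'a measure \<Rightarrow> ('a set \<Rightarrow> 'b::real_normed_vector) \<Rightarrow> bool" where
  "vector_measure M \<mu> \<longleftrightarrow>
     (\<forall>A :: nat \<Rightarrow> 'a set. range A \<subseteq> sets M \<longrightarrow> disjoint_family A \<longrightarrow>
        (\<lambda>n. \<mu> (A n)) sums \<mu> (\<Union>n. A n))"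

text \<open>Evaluated below only at Borel sets; at other sets this is the inner extension of \<open>|\<mu>|\<close>.\<close>

definition total_variation ::
  "'a measure \<Rightarrow> ('a set \<Rightarrow> 'b::real_normed_vector) \<Rightarrow> 'a set \<Rightarrow> ennreal" where
  "total_variation M \<mu> A =
     (SUP P\<in>{P. finite P \<and> disjoint P \<and> P \<subseteq> sets M \<and> \<Union>P \<subseteq> A}. \<Sum>B\<in>P. ennreal (norm (\<mu> B)))"

text \<open>The positive part of the Jordan decomposition, and integration with respect to a signed
  measure. The set \<open>B = {}\<close> makes the supremum nonnegative, so truncation by
  \<^term>\<open>ennreal\<close> is harmless.\<close>

definition positive_variation :: "'a measure \<Rightarrow> ('a set \<Rightarrow> real) \<Rightarrow> 'a measure" where
  "positive_variation M \<mu> =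
     measure_of (space M) (sets M) (\<lambda>A. SUP B\<in>{B\<in>sets M. B \<subseteq> A}. ennreal (\<mu> B))"

definition signed_integral :: "'a measure \<Rightarrow> ('a set \<Rightarrow> real) \<Rightarrow> ('a \<Rightarrow> real) \<Rightarrow> real" where
  "signed_integral M \<mu> f =
     integral\<^sup>L (positive_variation M \<mu>) f - integral\<^sup>L (positive_variation M (\<lambda>B. - \<mu> B)) f"


section \<open>The symmetrised distributional derivative\<close>

definition partial_deriv :: "2 \<Rightarrow> (plane \<Rightarrow> real) \<Rightarrow> plane \<Rightarrow> real" where
  "partial_deriv i f = (\<lambda>x. frechet_derivative f (at x) (axis i 1))"

text \<open>\<open>C\<^sup>\<infinity>\<close>: every iterated partial derivative is everywhere (Frechet) differentiable.\<close>

definition smooth_fun :: "(plane \<Rightarrow> real) \<Rightarrow> bool" where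
  "smooth_fun f \<longleftrightarrow> (\<forall>is x. foldr partial_deriv is f differentiable (at x))"

definition test_function :: "plane set \<Rightarrow> (plane \<Rightarrow> real) \<Rightarrow> bool" where
  "test_function \<Omega> \<phi> \<longleftrightarrow>
     smooth_fun \<phi> \<and> compact (closure {x. \<phi> x \<noteq> 0}) \<and> closure {x. \<phi> x \<noteq> 0} \<subseteq> \<Omega>"

abbreviation borel_on :: "plane set \<Rightarrow> plane measure" where
  "borel_on \<Omega> \<equiv> restrict_space borel \<Omega>"

definition is_sym_derivative ::
  "plane set \<Rightarrow> (plane \<Rightarrow> plane) \<Rightarrow> (plane set \<Rightarrow> matrix2) \<Rightarrow> bool" where
  "is_sym_derivative \<Omega> u \<mu> \<longleftrightarrow>
     vector_measure (borel_on \<Omega>) \<mu> \<and>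
     (\<forall>\<phi> i j. test_function \<Omega> \<phi> \<longrightarrow>
        - (1/2) * (LINT x:\<Omega>|lebesgue. u x $ i * partial_deriv j \<phi> x + u x $ j * partial_deriv i \<phi> x)
        = signed_integral (borel_on \<Omega>) (\<lambda>B. \<mu> B $ i $ j) \<phi>)"

text \<open>The measure \<open>Eu\<close>. It is unique on the Borel subsets of \<open>\<Omega>\<close>, the only sets at which it is
  ever evaluated.\<close>

definition sym_derivative :: "plane set \<Rightarrow> (plane \<Rightarrow> plane) \<Rightarrow> plane set \<Rightarrow> matrix2" where
  "sym_derivative \<Omega> u = (SOME \<mu>. is_sym_derivative \<Omega> u \<mu>)"

definition lebesgue_decomposition ::
  "plane set \<Rightarrow> (plane set \<Rightarrow> matrix2) \<Rightarrow> (plane \<Rightarrow> matrix2) \<Rightarrow> (plane set \<Rightarrow> matrix2) \<Rightarrow> bool" where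
  "lebesgue_decomposition \<Omega> \<mu> g \<mu>s \<longleftrightarrow>
     set_integrable lborel \<Omega> g \<and> vector_measure (borel_on \<Omega>) \<mu>s \<and>
     (\<exists>N\<in>sets (borel_on \<Omega>). emeasure lborel N = 0 \<and> (\<forall>B\<in>sets (borel_on \<Omega>). \<mu>s B = \<mu>s (B \<inter> N))) \<and>
     (\<forall>B\<in>sets (borel_on \<Omega>). \<mu> B = (LINT x:B|lborel. g x) + \<mu>s B)"

text \<open>The density \<open>e(u)\<close>, unique up to Lebesgue null sets, and the singular part \<open>E\<^sup>su\<close>.\<close>

definition approx_sym_gradient :: "plane set \<Rightarrow> (plane \<Rightarrow> plane) \<Rightarrow> plane \<Rightarrow> matrix2" where
  "approx_sym_gradient \<Omega> u = (SOME g. \<exists>\<mu>s. lebesgue_decomposition \<Omega> (sym_derivative \<Omega> u) g \<mu>s)"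

definition singular_sym_derivative :: "plane set \<Rightarrow> (plane \<Rightarrow> plane) \<Rightarrow> plane set \<Rightarrow> matrix2" where
  "singular_sym_derivative \<Omega> u =
     (SOME \<mu>s. \<exists>g. lebesgue_decomposition \<Omega> (sym_derivative \<Omega> u) g \<mu>s)"


section \<open>Approximate limits and special functions with bounded deformation\<close>

definition approx_limit :: "plane set \<Rightarrow> (plane \<Rightarrow> plane) \<Rightarrow> plane \<Rightarrow> plane \<Rightarrow> bool" where
  "approx_limit A u x v \<longleftrightarrow>
     ((\<lambda>\<rho>. (LINT y:(ball x \<rho> \<inter> A)|lebesgue. norm (u y - v)) / measure lebesgue (ball x \<rho> \<inter> A))
        \<longlongrightarrow> 0) (at_right 0)"

definition discontinuity_set :: "plane set \<Rightarrow> (plane \<Rightarrow> plane) \<Rightarrow> plane set" where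
  "discontinuity_set \<Omega> u = {x\<in>\<Omega>. \<not> (\<exists>v. approx_limit \<Omega> u x v)}"

definition jump_set :: "plane set \<Rightarrow> (plane \<Rightarrow> plane) \<Rightarrow> plane set" where
  "jump_set \<Omega> u =
     {x\<in>\<Omega>. \<exists>\<nu> a b. norm \<nu> = 1 \<and> a \<noteq> b \<and>
        approx_limit {y\<in>\<Omega>. 0 < (y - x) \<bullet> \<nu>} u x a \<and>
        approx_limit {y\<in>\<Omega>. (y - x) \<bullet> \<nu> < 0} u x b}"

definition SBD :: "plane set \<Rightarrow> (plane \<Rightarrow> plane) set" where
  "SBD \<Omega> = {u. u absolutely_integrable_on \<Omega> \<and>
     (\<exists>\<mu>. is_sym_derivative \<Omega> u \<mu>) \<and>
     total_variation (borel_on \<Omega>) (sym_derivative \<Omega> u) \<Omega> < \<infinity> \<and>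
     total_variation (borel_on \<Omega>) (singular_sym_derivative \<Omega> u) (\<Omega> - jump_set \<Omega> u) = 0}"

definition equals_on_boundary ::
  "plane set \<Rightarrow> (plane \<Rightarrow> plane) \<Rightarrow> (plane \<Rightarrow> plane) \<Rightarrow> bool" where
  "equals_on_boundary \<Omega> u u0 \<longleftrightarrow> (\<forall>x\<in>frontier \<Omega>. \<forall>v. approx_limit \<Omega> u x v \<longrightarrow> v = u0 x)"


section \<open>Cells and micro-fractures\<close>

definition place :: "real \<Rightarrow> plane \<Rightarrow> plane set \<Rightarrow> plane set" where
  "place \<epsilon> z A = (\<lambda>y. z + \<epsilon> *\<^sub>R y) ` A"

definition cell :: "real \<Rightarrow> plane \<Rightarrow> plane set" where
  "cell \<epsilon> z = place \<epsilon> z (cbox 0 1)"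

definition cell_points :: "real \<Rightarrow> plane set \<Rightarrow> plane set" where
  "cell_points \<epsilon> \<Omega> =
     {z. (\<exists>m n :: int. z = vector [\<epsilon> * of_int m, \<epsilon> * of_int n]) \<and> cell \<epsilon> z \<subseteq> \<Omega>}"

text \<open>A distribution of micro-fractures is given by the unscaled curves \<open>K z\<close> in the open unit
  square, one for each cell.\<close>

definition fracture_family :: "real \<Rightarrow> plane set \<Rightarrow> (plane \<Rightarrow> plane set) \<Rightarrow> bool" where
  "fracture_family \<epsilon> \<Omega> K \<longleftrightarrow> (\<forall>z\<in>cell_points \<epsilon> \<Omega>. lipschitz_curve (K z) \<and> K z \<subseteq> box 0 1)"

definition micro_fractures :: "real \<Rightarrow> plane set \<Rightarrow> (plane \<Rightarrow> plane set) \<Rightarrow> plane set" where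
  "micro_fractures \<epsilon> \<Omega> K = (\<Union>z\<in>cell_points \<epsilon> \<Omega>. place \<epsilon> z (K z))"


section \<open>Energy and approximate minimizers\<close>

definition Adm :: "plane set \<Rightarrow> plane set \<Rightarrow> (plane \<Rightarrow> plane) \<Rightarrow> (plane \<Rightarrow> plane) set" where
  "Adm \<Omega> F u0 = {u\<in>SBD \<Omega>. equals_on_boundary \<Omega> u u0 \<and> F \<subseteq> discontinuity_set \<Omega> u}"

text \<open>The value may be \<open>\<infinity>\<close>. Since \<open>e(u)\<close> is symmetric almost everywhere, \<^term>\<open>ennreal\<close> does not
  truncate the bulk term when \<open>w\<close> is positive definite.\<close>

definition energy ::
  "plane set \<Rightarrow> (matrix2 \<Rightarrow> real) \<Rightarrow> real \<Rightarrow> plane set \<Rightarrow> (plane \<Rightarrow> plane) \<Rightarrow> ennreal" where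
  "energy \<Omega> w G F u =
     (\<integral>\<^sup>+x\<in>\<Omega>. ennreal (w (approx_sym_gradient \<Omega> u x)) \<partial>lebesgue)
     + ennreal G * hausdorff1 (discontinuity_set \<Omega> u - F)"

definition inf_energy ::
  "plane set \<Rightarrow> (matrix2 \<Rightarrow> real) \<Rightarrow> real \<Rightarrow> plane set \<Rightarrow> (plane \<Rightarrow> plane) \<Rightarrow> ennreal" where
  "inf_energy \<Omega> w G F u0 = (INF v\<in>Adm \<Omega> F u0. energy \<Omega> w G F v)"

definition approx_minimizer ::
  "real \<Rightarrow> plane set \<Rightarrow> (matrix2 \<Rightarrow> real) \<Rightarrow> real \<Rightarrow> plane set \<Rightarrow> (plane \<Rightarrow> plane) \<Rightarrow>
   (plane \<Rightarrow> plane) \<Rightarrow> bool" where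
  "approx_minimizer \<delta> \<Omega> w G F u0 u \<longleftrightarrow>
     u \<in> Adm \<Omega> F u0 \<and> energy \<Omega> w G F u \<le> ennreal \<delta> + inf_energy \<Omega> w G F u0"


section \<open>Active cells\<close>

definition emergent_crack ::
  "real \<Rightarrow> plane set \<Rightarrow> (plane \<Rightarrow> plane set) \<Rightarrow> (plane \<Rightarrow> plane) \<Rightarrow> plane \<Rightarrow> plane set" where
  "emergent_crack \<epsilon> \<Omega> K u z = cell \<epsilon> z \<inter> (discontinuity_set \<Omega> u - place \<epsilon> z (K z))"

definition active_points ::
  "real \<Rightarrow> real \<Rightarrow> plane set \<Rightarrow> (plane \<Rightarrow> plane set) \<Rightarrow> (plane \<Rightarrow> plane) \<Rightarrow> plane set" where
  "active_points \<epsilon> l \<Omega> K u =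
     {z\<in>cell_points \<epsilon> \<Omega>. ennreal (\<epsilon> * l) \<le> hausdorff1 (emergent_crack \<epsilon> \<Omega> K u z)}"

definition active_count ::
  "real \<Rightarrow> real \<Rightarrow> plane set \<Rightarrow> (plane \<Rightarrow> plane set) \<Rightarrow> (plane \<Rightarrow> plane) \<Rightarrow> nat" where
  "active_count \<epsilon> l \<Omega> K u = card (active_points \<epsilon> l \<Omega> K u)"

definition damaged ::
  "real \<Rightarrow> real \<Rightarrow> plane set \<Rightarrow> (plane \<Rightarrow> plane set) \<Rightarrow> (plane \<Rightarrow> plane) \<Rightarrow> plane set" where
  "damaged \<epsilon> l \<Omega> K u = (\<Union>z\<in>active_points \<epsilon> l \<Omega> K u. cell \<epsilon> z)"

end

theory Submission
  imports Defs
begin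

text \<open>The emergent crack in a cell is the part of \<open>S\<^sub>u - F\<close> in that (closed) cell, and each active cell
  carries at least \<open>\<epsilon> l\<close> of it, while the energy bound controls the total. Closed cells overlap and
  \<open>S\<^sub>u\<close> is not known to be measurable, so the contributions are added up within each of the four
  classes of cells with equal parities of the lattice coordinates: distinct cells of one class are
  at distance at least \<open>\<epsilon>\<close>, and Hausdorff measure is additive on separated sets.\<close>

section \<open>Hausdorff measure of separated sets\<close>

lemma hausdorff1_pre_mono: "A \<subseteq> B \<Longrightarrow> hausdorff1_pre d A \<le> hausdorff1_pre d B"
  unfolding hausdorff1_pre_def by (rule INF_superset_mono) auto

lemma hausdorff1_mono: "A \<subseteq> B \<Longrightarrow> hausdorff1 A \<le> hausdorff1 B"
  unfolding hausdorff1_def by (rule SUP_mono') (rule hausdorff1_pre_mono)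

text \<open>A smaller scale admits fewer covers, so the infimum can only grow.\<close>

lemma hausdorff1_pre_antimono: "d \<le> e \<Longrightarrow> hausdorff1_pre e A \<le> hausdorff1_pre d A"
  unfolding hausdorff1_pre_def
  by (rule INF_superset_mono, rule Collect_mono) (blast intro: order_trans, rule order_refl)

text \<open>No covering set of diameter at most \<open>d\<close> can meet both \<open>A\<close> and
  \<open>B\<close>, so a cover of the union splits into a cover of each, and every diameter is spent
  only once.\<close>

lemma hausdorff1_pre_add_separated:
  fixes A B :: "'a::metric_space set"
  assumes sep: "\<And>x y. x \<in> A \<Longrightarrow> y \<in> B \<Longrightarrow> d < dist x y" and "0 < d"
  shows "hausdorff1_pre d A + hausdorff1_pre d B \<le> hausdorff1_pre d (A \<union> B)"
  unfolding hausdorff1_pre_def [of d "A \<union> B"]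
proof (rule INF_greatest, clarify)
  fix C :: "nat \<Rightarrow> 'a set"
  assume cover: "A \<union> B \<subseteq> (\<Union>i. C i)" and C: "\<forall>i. bounded (C i) \<and> diameter (C i) \<le> d"
  \<comment> \<open>Members that miss the set become empty instead of being dropped, which keeps the
    index set; the empty set has diameter 0, admissible since \<open>0 < d\<close>.\<close>
  define CA where "CA i = (if C i \<inter> A = {} then {} else C i)" for i
  define CB where "CB i = (if C i \<inter> B = {} then {} else C i)" for i
  have disj: "C i \<inter> A = {} \<or> C i \<inter> B = {}" for i
  proof (rule ccontr)
    assume "\<not> ?thesis"
    then obtain x y where "x \<in> C i" "x \<in> A" "y \<in> C i" "y \<in> B" by blast
    moreover from this have "dist x y \<le> diameter (C i)"
      using C diameter_bounded_bound by blast
    ultimately show False using sep [of x y] C by (meson not_less order_trans)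
  qed
  have "hausdorff1_pre d A \<le> (\<Sum>i. ennreal (diameter (CA i)))"
    unfolding hausdorff1_pre_def
  proof (rule INF_lower, rule CollectI, intro conjI allI)
    show "A \<subseteq> (\<Union>i. CA i)"
    proof
      fix x
      assume "x \<in> A"
      then obtain i where "x \<in> C i" using cover by blast
      with \<open>x \<in> A\<close> have "x \<in> CA i" by (auto simp: CA_def)
      then show "x \<in> (\<Union>i. CA i)" by blast
    qed
    show "bounded (CA i)" "diameter (CA i) \<le> d" for i
      using C \<open>0 < d\<close> by (simp_all add: CA_def)
  qed
  moreover have "hausdorff1_pre d B \<le> (\<Sum>i. ennreal (diameter (CB i)))"
    unfolding hausdorff1_pre_def
  proof (rule INF_lower, rule CollectI, intro conjI allI)
    show "B \<subseteq> (\<Union>i. CB i)"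
    proof
      fix x
      assume "x \<in> B"
      then obtain i where "x \<in> C i" using cover by blast
      with \<open>x \<in> B\<close> have "x \<in> CB i" by (auto simp: CB_def)
      then show "x \<in> (\<Union>i. CB i)" by blast
    qed
    show "bounded (CB i)" "diameter (CB i) \<le> d" for i
      using C \<open>0 < d\<close> by (simp_all add: CB_def)
  qed
  ultimately have "hausdorff1_pre d A + hausdorff1_pre d B
      \<le> (\<Sum>i. ennreal (diameter (CA i))) + (\<Sum>i. ennreal (diameter (CB i)))"
    by (rule add_mono)
  also have "\<dots> = (\<Sum>i. ennreal (diameter (CA i)) + ennreal (diameter (CB i)))"
    by (rule suminf_add) auto
  also have "\<dots> \<le> (\<Sum>i. ennreal (diameter (C i)))"
  proof (rule suminf_le)
    \<comment> \<open>By \<open>disj\<close> at least one of \<open>CA i\<close> and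
      \<open>CB i\<close> is empty and contributes 0.\<close>
    show "ennreal (diameter (CA i)) + ennreal (diameter (CB i)) \<le> ennreal (diameter (C i))" for i
      using disj [of i] by (auto simp: CA_def CB_def)
  qed auto
  finally show "hausdorff1_pre d A + hausdorff1_pre d B \<le> (\<Sum>i. ennreal (diameter (C i)))" .
qed

text \<open>The pre-measures grow as the scale shrinks, so the sum of the two suprema is the
  supremum of the sums, and only scales below \<open>e\<close> matter; there the previous lemma
  applies.\<close>

lemma hausdorff1_add_separated:
  fixes A B :: "'a::metric_space set"
  assumes sep: "\<And>x y. x \<in> A \<Longrightarrow> y \<in> B \<Longrightarrow> e \<le> dist x y" and "0 < e"
  shows "hausdorff1 A + hausdorff1 B \<le> hausdorff1 (A \<union> B)"
proof -
  have "hausdorff1 A + hausdorff1 B = (SUP d\<in>{0<..}. hausdorff1_pre d A + hausdorff1_pre d B)"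
    unfolding hausdorff1_def
  proof (rule SUP_add_directed_ennreal [symmetric])
    fix i j :: real
    assume "i \<in> {0<..}" "j \<in> {0<..}"
    then show "\<exists>k\<in>{0<..}. hausdorff1_pre i A + hausdorff1_pre j B
        \<le> hausdorff1_pre k A + hausdorff1_pre k B"
      by (intro bexI [of _ "min i j"] add_mono hausdorff1_pre_antimono) auto
  qed
  also have "\<dots> \<le> hausdorff1 (A \<union> B)"
  proof (rule SUP_least)
    fix d :: real
    assume "d \<in> {0<..}"
    \<comment> \<open>Halving \<open>e\<close> provides the strict inequality
      \<open>k < dist x y\<close> that the lemma at a fixed scale asks for.\<close>
    define k where "k = min d (e / 2)"
    have "0 < k" "k \<le> d" "k < e" using \<open>d \<in> {0<..}\<close> \<open>0 < e\<close> by (auto simp: k_def)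
    then have "hausdorff1_pre d A + hausdorff1_pre d B \<le> hausdorff1_pre k A + hausdorff1_pre k B"
      by (intro add_mono hausdorff1_pre_antimono)
    also have "\<dots> \<le> hausdorff1_pre k (A \<union> B)"
      using sep \<open>0 < k\<close> \<open>k < e\<close> by (intro hausdorff1_pre_add_separated) force+
    also have "\<dots> \<le> hausdorff1 (A \<union> B)"
      unfolding hausdorff1_def using \<open>0 < k\<close> by (intro SUP_upper) auto
    finally show "hausdorff1_pre d A + hausdorff1_pre d B \<le> hausdorff1 (A \<union> B)" .
  qed
  finally show ?thesis .
qed

text \<open>Induction works because the gap \<open>e\<close> is uniform over all pairs: each new set
  then keeps distance at least \<open>e\<close> from the union of the others.\<close>

lemma hausdorff1_sum_separated:
  fixes A :: "'i \<Rightarrow> 'a::metric_space set"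
  assumes "finite T" and "0 < e"
    and "\<And>i j x y. i \<in> T \<Longrightarrow> j \<in> T \<Longrightarrow> i \<noteq> j \<Longrightarrow> x \<in> A i \<Longrightarrow> y \<in> A j \<Longrightarrow> e \<le> dist x y"
  shows "(\<Sum>i\<in>T. hausdorff1 (A i)) \<le> hausdorff1 (\<Union>i\<in>T. A i)"
  using assms(1,3)
proof (induction T)
  case (insert i T)
  have "(\<Sum>j\<in>insert i T. hausdorff1 (A j)) \<le> hausdorff1 (A i) + hausdorff1 (\<Union>j\<in>T. A j)"
    using insert by (auto intro!: add_left_mono)
  also have "\<dots> \<le> hausdorff1 (A i \<union> (\<Union>j\<in>T. A j))"
  proof (rule hausdorff1_add_separated [OF _ \<open>0 < e\<close>])
    fix x y
    assume "x \<in> A i" "y \<in> (\<Union>j\<in>T. A j)"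
    then show "e \<le> dist x y" using insert.hyps insert.prems by blast
  qed
  finally show ?case by simp
qed simp

section \<open>Cells\<close>

lemma mem_cell:
  assumes "0 < \<epsilon>"
  shows "x \<in> cell \<epsilon> z \<longleftrightarrow> (\<forall>i. z $ i \<le> x $ i \<and> x $ i \<le> z $ i + \<epsilon>)"
proof
  assume "x \<in> cell \<epsilon> z"
  then show "\<forall>i. z $ i \<le> x $ i \<and> x $ i \<le> z $ i + \<epsilon>"
    using assms by (auto simp: cell_def place_def mem_box_cart mult_left_le)
next
  assume x: "\<forall>i. z $ i \<le> x $ i \<and> x $ i \<le> z $ i + \<epsilon>"
  have "x = z + \<epsilon> *\<^sub>R ((1 / \<epsilon>) *\<^sub>R (x - z))" using assms by simp
  moreover have "(1 / \<epsilon>) *\<^sub>R (x - z) \<in> cbox 0 1"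
    using x assms by (auto simp: mem_box_cart field_simps)
  ultimately show "x \<in> cell \<epsilon> z" unfolding cell_def place_def by blast
qed

text \<open>Rewrites the cell as an affine image of a box, for which measurability and content are
  known.\<close>

lemma cell_eq_affinity: "cell \<epsilon> z = (\<lambda>y. \<epsilon> *\<^sub>R y + z) ` cbox 0 1"
  by (simp add: cell_def place_def add.commute)

lemma cell_lmeasurable: "cell \<epsilon> z \<in> lmeasurable"
  unfolding cell_eq_affinity image_affinity_cbox by auto

lemma measure_cell: "0 < \<epsilon> \<Longrightarrow> measure lebesgue (cell \<epsilon> z) = \<epsilon>\<^sup>2"
proof -
  have "measure lborel (cbox (0::plane) 1) = 1" by (simp add: content_cbox_if_cart interval_ne_empty_cart)
  then show "measure lebesgue (cell \<epsilon> z) = \<epsilon>\<^sup>2"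
    unfolding cell_eq_affinity using content_image_affinity_cbox [of \<epsilon> z 0 1]
    by (simp add: image_affinity_cbox measure_completion)
qed

text \<open>Turns the pair of lattice coordinates into a function of the index, so that later
  arguments can treat an arbitrary coordinate \<open>i\<close>.\<close>

lemma cell_pointsE:
  assumes "z \<in> cell_points \<epsilon> \<Omega>"
  obtains k :: "2 \<Rightarrow> int" where "\<And>i. z $ i = \<epsilon> * of_int (k i)"
proof -
  obtain m n :: int where "z = vector [\<epsilon> * of_int m, \<epsilon> * of_int n]"
    using assms unfolding cell_points_def by blast
  then have "\<forall>i. z $ i = \<epsilon> * of_int (if i = 1 then m else n)"
    by (simp add: forall_2)
  then show thesis by (intro that) (rule spec)
qed

text \<open>A point of the open square, placed at \<open>z'\<close>, has coordinates strictly
  between consecutive multiples of \<open>\<epsilon>\<close>, so no other closed lattice cell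
  contains it.\<close>

lemma cell_disjoint_place:
  assumes "0 < \<epsilon>" and z: "z \<in> cell_points \<epsilon> \<Omega>" and z': "z' \<in> cell_points \<epsilon> \<Omega>" and "z \<noteq> z'"
    and A: "A \<subseteq> box 0 1"
  shows "cell \<epsilon> z \<inter> place \<epsilon> z' A = {}"
proof (rule ccontr)
  assume "\<not> ?thesis"
  then obtain y where x: "z' + \<epsilon> *\<^sub>R y \<in> cell \<epsilon> z" and "y \<in> A" unfolding place_def by blast
  obtain k where k: "\<And>i. z $ i = \<epsilon> * of_int (k i)" using cell_pointsE [OF z] by blast
  obtain k' where k': "\<And>i. z' $ i = \<epsilon> * of_int (k' i)" using cell_pointsE [OF z'] by blast
  have "k i = k' i" for i
  proof -
    have y: "0 < y $ i" "y $ i < 1" using \<open>y \<in> A\<close> A by (auto simp: mem_box_cart)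
    have "\<epsilon> * of_int (k i) \<le> \<epsilon> * (of_int (k' i) + y $ i)"
      "\<epsilon> * (of_int (k' i) + y $ i) \<le> \<epsilon> * (of_int (k i) + 1)"
      using x assms(1) k k' by (auto simp: mem_cell algebra_simps)
    then have "of_int (k i) \<le> of_int (k' i) + y $ i" "of_int (k' i) + y $ i \<le> of_int (k i) + 1"
      using \<open>0 < \<epsilon>\<close> by auto
    \<comment> \<open>Strictness gives \<open>k i < k' i + 1\<close> and
      \<open>k' i < k i + 1\<close>, which for integers means equality.\<close>
    then show ?thesis using y by linarith
  qed
  then show False using \<open>z \<noteq> z'\<close> by (simp add: vec_eq_iff k k')
qed

text \<open>Fractures of other cells never reach this one, so removing all of them changes nothing
  inside it. All emergent cracks thus become traces of one set independent of \<open>z\<close>, the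
  set measured in the energy.\<close>

lemma emergent_crack_eq:
  assumes "0 < \<epsilon>" and "fracture_family \<epsilon> \<Omega> K" and "z \<in> cell_points \<epsilon> \<Omega>"
  shows "emergent_crack \<epsilon> \<Omega> K u z
    = cell \<epsilon> z \<inter> (discontinuity_set \<Omega> u - micro_fractures \<epsilon> \<Omega> K)"
proof -
  have "cell \<epsilon> z \<inter> micro_fractures \<epsilon> \<Omega> K = cell \<epsilon> z \<inter> place \<epsilon> z (K z)"
  proof -
    have "cell \<epsilon> z \<inter> place \<epsilon> z' (K z') = {}" if "z' \<in> cell_points \<epsilon> \<Omega>" "z' \<noteq> z" for z'
      using cell_disjoint_place [OF assms(1,3) that(1)] that assms(2)
      unfolding fracture_family_def by blast
    then show ?thesis using assms(3) unfolding micro_fractures_def by blast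
  qed
  then show ?thesis unfolding emergent_crack_def by blast
qed

text \<open>For \<open>\<epsilon> > 0\<close> and a lattice point the quotients are already
  integers; the floor only converts their type.\<close>

definition parity_class :: "real \<Rightarrow> plane \<Rightarrow> int \<times> int" where
  "parity_class \<epsilon> z = (\<lfloor>z $ 1 / \<epsilon>\<rfloor> mod 2, \<lfloor>z $ 2 / \<epsilon>\<rfloor> mod 2)"

text \<open>In some coordinate the corners differ by at least \<open>2 * \<epsilon>\<close>; the
  width of a cell uses up one \<open>\<epsilon>\<close> and the other remains as a gap.\<close>

lemma cells_same_parity_separated:
  assumes "0 < \<epsilon>" and z: "z \<in> cell_points \<epsilon> \<Omega>" and z': "z' \<in> cell_points \<epsilon> \<Omega>" and "z \<noteq> z'"
    and par: "parity_class \<epsilon> z = parity_class \<epsilon> z'"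
    and x: "x \<in> cell \<epsilon> z" and x': "x' \<in> cell \<epsilon> z'"
  shows "\<epsilon> \<le> dist x x'"
proof -
  obtain k where k: "\<And>i. z $ i = \<epsilon> * of_int (k i)" using cell_pointsE [OF z] by blast
  obtain k' where k': "\<And>i. z' $ i = \<epsilon> * of_int (k' i)" using cell_pointsE [OF z'] by blast
  have mod: "\<forall>i. k i mod 2 = k' i mod 2"
    using par \<open>0 < \<epsilon>\<close> unfolding forall_2 parity_class_def by (simp add: k k')
  obtain i where "k i \<noteq> k' i" using \<open>z \<noteq> z'\<close> by (auto simp: vec_eq_iff k k')
  \<comment> \<open>Distinct integers of equal parity differ by at least two.\<close>
  then have "k i + 2 \<le> k' i \<or> k' i + 2 \<le> k i" using mod [rule_format, of i] by presburger
  then have "\<epsilon> * (of_int (k i) + 2) \<le> \<epsilon> * of_int (k' i) \<or> \<epsilon> * (of_int (k' i) + 2) \<le> \<epsilon> * of_int (k i)"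
    using \<open>0 < \<epsilon>\<close> by (simp add: mult_le_cancel_left_pos) linarith
  then have "z $ i + 2 * \<epsilon> \<le> z' $ i \<or> z' $ i + 2 * \<epsilon> \<le> z $ i"
    unfolding k k' by (simp add: distrib_left mult.commute)
  moreover have "z $ i \<le> x $ i" "x $ i \<le> z $ i + \<epsilon>" "z' $ i \<le> x' $ i" "x' $ i \<le> z' $ i + \<epsilon>"
    using x x' mem_cell [OF \<open>0 < \<epsilon>\<close>] by blast+
  ultimately have "\<epsilon> \<le> \<bar>x $ i - x' $ i\<bar>" by linarith
  also have "\<dots> \<le> dist x x'"
    using component_le_norm_cart [of "x - x'" i] by (simp add: dist_norm)
  finally show ?thesis .
qed

text \<open>The factor 4 is the number of parity classes: within one class the traces are separated,
  so together they cost at most \<open>hausdorff1 S\<close>.\<close>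

lemma sum_hausdorff1_cells_le:
  assumes "0 < \<epsilon>" and "finite T" and T: "T \<subseteq> cell_points \<epsilon> \<Omega>"
  shows "(\<Sum>z\<in>T. hausdorff1 (cell \<epsilon> z \<inter> S)) \<le> 4 * hausdorff1 S"
proof -
  let ?P = "{0, 1} \<times> {0, 1} :: (int \<times> int) set"
  have "(\<Sum>z\<in>T. hausdorff1 (cell \<epsilon> z \<inter> S))
      = (\<Sum>c\<in>?P. \<Sum>z\<in>{z\<in>T. parity_class \<epsilon> z = c}. hausdorff1 (cell \<epsilon> z \<inter> S))"
    by (rule sum.group [symmetric]) (use \<open>finite T\<close> in \<open>auto simp: parity_class_def\<close>)
  also have "\<dots> \<le> (\<Sum>c\<in>?P. hausdorff1 S)"
  proof (rule sum_mono)
    fix c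
    let ?Tc = "{z\<in>T. parity_class \<epsilon> z = c}"
    have "(\<Sum>z\<in>?Tc. hausdorff1 (cell \<epsilon> z \<inter> S)) \<le> hausdorff1 (\<Union>z\<in>?Tc. cell \<epsilon> z \<inter> S)"
    proof (rule hausdorff1_sum_separated [OF _ \<open>0 < \<epsilon>\<close>])
      show "finite ?Tc" using \<open>finite T\<close> by simp
    next
      fix z z' x x'
      assume "z \<in> ?Tc" "z' \<in> ?Tc" "z \<noteq> z'" "x \<in> cell \<epsilon> z \<inter> S" "x' \<in> cell \<epsilon> z' \<inter> S"
      then show "\<epsilon> \<le> dist x x'"
        using T by (intro cells_same_parity_separated [OF \<open>0 < \<epsilon>\<close>, of z \<Omega> z']) auto
    qed
    also have "\<dots> \<le> hausdorff1 S" by (rule hausdorff1_mono) blast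
    finally show "(\<Sum>z\<in>?Tc. hausdorff1 (cell \<epsilon> z \<inter> S)) \<le> hausdorff1 S" .
  qed
  also have "\<dots> = 4 * hausdorff1 S" by (simp add: card_cartesian_product)
  finally show ?thesis .
qed

section \<open>Counting active cells\<close>

text \<open>Each active cell carries surface energy at least \<open>G * \<epsilon> * l\<close>, and
  these contributions sum to at most \<open>4 * b\<close>. Finiteness needs its own proof, since
  \<open>card\<close> is 0 on infinite sets.\<close>

lemma active_points_card_le:
  assumes "0 < \<epsilon>" and "0 < l" and "0 < G" and "0 \<le> b"
    and K: "fracture_family \<epsilon> \<Omega> K"
    and energy: "energy \<Omega> w G (micro_fractures \<epsilon> \<Omega> K) u \<le> ennreal b"
  shows "finite (active_points \<epsilon> l \<Omega> K u)"
    and "real (card (active_points \<epsilon> l \<Omega> K u)) \<le> 4 * b / (G * l) / \<epsilon>"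
proof -
  define S where "S = discontinuity_set \<Omega> u - micro_fractures \<epsilon> \<Omega> K"
  define N where "N = 4 * b / (G * l) / \<epsilon>"
  \<comment> \<open>Bounding arbitrary finite subsets first avoids presupposing finiteness, which
    then follows from the uniformity of the bound.\<close>
  have bound: "real (card T) \<le> N" if T: "T \<subseteq> active_points \<epsilon> l \<Omega> K u" "finite T" for T
  proof -
    have cp: "T \<subseteq> cell_points \<epsilon> \<Omega>" using T(1) by (auto simp: active_points_def)
    have "ennreal (real (card T) * (\<epsilon> * l)) = (\<Sum>z\<in>T. ennreal (\<epsilon> * l))"
      using assms(1,2) by (simp add: ennreal_mult ennreal_of_nat_eq_real_of_nat)
    also have "\<dots> \<le> (\<Sum>z\<in>T. hausdorff1 (cell \<epsilon> z \<inter> S))"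
    proof (rule sum_mono)
      fix z
      assume "z \<in> T"
      then show "ennreal (\<epsilon> * l) \<le> hausdorff1 (cell \<epsilon> z \<inter> S)"
        using T(1) emergent_crack_eq [OF assms(1) K, of z u]
        by (auto simp: active_points_def S_def)
    qed
    also have "\<dots> \<le> 4 * hausdorff1 S"
      by (rule sum_hausdorff1_cells_le [OF assms(1) T(2) cp])
    finally have "ennreal G * ennreal (real (card T) * (\<epsilon> * l)) \<le> ennreal G * (4 * hausdorff1 S)"
      by (rule mult_left_mono) simp
    also have "\<dots> = 4 * (ennreal G * hausdorff1 S)"
      by (simp add: mult.left_commute)
    also have "\<dots> \<le> 4 * ennreal b"
    proof (rule mult_left_mono)
      \<comment> \<open>The bulk term is nonnegative as an \<open>ennreal\<close> and is
        discarded.\<close>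
      have "ennreal G * hausdorff1 S \<le> energy \<Omega> w G (micro_fractures \<epsilon> \<Omega> K) u"
        unfolding energy_def S_def by (rule add_increasing) simp_all
      then show "ennreal G * hausdorff1 S \<le> ennreal b" using energy by (rule order_trans)
    qed simp
    finally have "ennreal (G * (real (card T) * (\<epsilon> * l))) \<le> ennreal (4 * b)"
      using assms(1-4) by (simp add: ennreal_mult)
    \<comment> \<open>Since \<open>0 \<le> b\<close>, \<open>ennreal\<close> does not truncate the
      right-hand side, and the inequality descends to the reals.\<close>
    then have "G * (real (card T) * (\<epsilon> * l)) \<le> 4 * b" using \<open>0 \<le> b\<close> by simp
    then show ?thesis using assms(1-3) by (simp add: N_def field_simps)
  qed
  have "finite (active_points \<epsilon> l \<Omega> K u) \<and> card (active_points \<epsilon> l \<Omega> K u) \<le> nat \<lfloor>N\<rfloor>"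
  proof (rule finite_if_finite_subsets_card_bdd)
    fix T
    assume "T \<subseteq> active_points \<epsilon> l \<Omega> K u" "finite T"
    then show "card T \<le> nat \<lfloor>N\<rfloor>" using bound [of T] by linarith
  qed
  then show fin: "finite (active_points \<epsilon> l \<Omega> K u)" by blast
  show "real (card (active_points \<epsilon> l \<Omega> K u)) \<le> 4 * b / (G * l) / \<epsilon>"
    using bound [OF subset_refl fin] by (simp add: N_def)
qed

text \<open>Subadditivity is enough here, so edges shared by neighbouring cells do no harm.\<close>

lemma measure_damaged_le:
  assumes "0 < \<epsilon>" and "finite (active_points \<epsilon> l \<Omega> K u)"
  shows "measure lebesgue (damaged \<epsilon> l \<Omega> K u) \<le> real (card (active_points \<epsilon> l \<Omega> K u)) * \<epsilon>\<^sup>2"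
proof -
  have "measure lebesgue (damaged \<epsilon> l \<Omega> K u)
      \<le> (\<Sum>z\<in>active_points \<epsilon> l \<Omega> K u. measure lebesgue (cell \<epsilon> z))"
    unfolding damaged_def
    by (rule measure_UNION_le) (use assms(2) cell_lmeasurable in \<open>auto dest: fmeasurableD\<close>)
  then show ?thesis using assms(1) by (simp add: measure_cell)
qed

theorem theorem4p2:
  fixes \<Omega> :: "plane set" and w :: "matrix2 \<Rightarrow> real" and G l \<delta> :: real
    and u0 :: "plane \<Rightarrow> plane"
    and \<epsilon> :: "nat \<Rightarrow> real"
    and K :: "nat \<Rightarrow> plane \<Rightarrow> plane set"
    and F :: "nat \<Rightarrow> plane set"
    and u :: "nat \<Rightarrow> plane \<Rightarrow> plane"
  assumes "open \<Omega>" and "bounded \<Omega>" and "locally_lipschitz_boundary \<Omega>"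
    and "quadratic_on_symmetric w" and "positive_definite_on_symmetric w"
    and "G > 0" and "l > 0"
    and "continuous_on (frontier \<Omega>) u0"
    and "\<delta> > 0"
    and "\<And>n. \<epsilon> n > 0" and "\<epsilon> \<longlonglongrightarrow> 0"
    and "\<And>n. fracture_family (\<epsilon> n) \<Omega> (K n)"
    and "\<And>n. F n = micro_fractures (\<epsilon> n) \<Omega> (K n)"
    and "\<And>n. approx_minimizer \<delta> \<Omega> w G (F n) u0 (u n)"
    and "\<exists>B::real. \<forall>n. inf_energy \<Omega> w G (F n) u0 \<le> ennreal B"
  shows "\<exists>C::real. \<forall>n.
           real (active_count (\<epsilon> n) l \<Omega> (K n) (u n)) \<le> C / \<epsilon> n \<and>
           measure lebesgue (damaged (\<epsilon> n) l \<Omega> (K n) (u n)) \<le> C * \<epsilon> n"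
proof -
  obtain B :: real where B: "\<And>n. inf_energy \<Omega> w G (F n) u0 \<le> ennreal B" using assms(15) by blast
  \<comment> \<open>The given bound \<open>B\<close> may be negative, in which case
    \<open>ennreal B\<close> is 0; the maximum covers this case and makes \<open>b\<close>
    nonnegative.\<close>
  define b where "b = \<delta> + max 0 B"
  have "0 \<le> b" using \<open>\<delta> > 0\<close> by (simp add: b_def)
  have energy: "energy \<Omega> w G (micro_fractures (\<epsilon> n) \<Omega> (K n)) (u n) \<le> ennreal b" for n
  proof -
    have "energy \<Omega> w G (F n) (u n) \<le> ennreal \<delta> + inf_energy \<Omega> w G (F n) u0"
      using assms(14) by (simp add: approx_minimizer_def)
    also have "\<dots> \<le> ennreal \<delta> + ennreal (max 0 B)"
      by (intro add_left_mono order_trans [OF B] ennreal_leI) simp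
    also have "\<dots> = ennreal b" using \<open>\<delta> > 0\<close> by (simp add: b_def ennreal_plus)
    finally show ?thesis by (simp only: assms(13))
  qed
  \<comment> \<open>Built from \<open>\<delta>\<close>, \<open>B\<close>, \<open>G\<close> and
    \<open>l\<close> only, hence the same for every \<open>n\<close>.\<close>
  define C where "C = 4 * b / (G * l)"
  have "real (active_count (\<epsilon> n) l \<Omega> (K n) (u n)) \<le> C / \<epsilon> n \<and>
      measure lebesgue (damaged (\<epsilon> n) l \<Omega> (K n) (u n)) \<le> C * \<epsilon> n" for n
  proof
    let ?A = "active_points (\<epsilon> n) l \<Omega> (K n) (u n)"
    note active = active_points_card_le [OF assms(10,7,6) \<open>0 \<le> b\<close> assms(12) energy, of n]
    have card: "real (card ?A) \<le> C / \<epsilon> n" using active(2) by (simp add: C_def)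
    then show "real (active_count (\<epsilon> n) l \<Omega> (K n) (u n)) \<le> C / \<epsilon> n" by (simp add: active_count_def)
    have "measure lebesgue (damaged (\<epsilon> n) l \<Omega> (K n) (u n)) \<le> real (card ?A) * (\<epsilon> n)\<^sup>2"
      by (rule measure_damaged_le [OF assms(10) active(1)])
    \<comment> \<open>At most \<open>C / \<epsilon> n\<close> cells of area
      \<open>(\<epsilon> n)\<^sup>2\<close> leave one factor \<open>\<epsilon> n\<close>, so the
      constant of the count also serves for the area.\<close>
    also have "\<dots> \<le> C / \<epsilon> n * (\<epsilon> n)\<^sup>2" by (rule mult_right_mono [OF card]) simp
    also have "\<dots> = C * \<epsilon> n" by (simp add: power2_eq_square)
    finally show "measure lebesgue (damaged (\<epsilon> n) l \<Omega> (K n) (u n)) \<le> C * \<epsilon> n" .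
  qed
  then show ?thesis by blast
qed

end
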